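(* Let $n\ge 1$, let $\Omega\subset\mathbb{R}^n$ be a bounded connected open set, let $F\in C^0(\Omega\times\mathbb{R}\times\mathbb{R}^n\times\mathcal{S}^{n\times n})$ be degenerate elliptic, i.e. $$F(x,s,p,M+N)\ge F(x,s,p,M)\quad\text{for all }(x,s,p,M)\in\Omega\times\mathbb{R}\times\mathbb{R}^n\times\mathcal{S}^{n\times n}\text{ and all }N\in\mathcal{S}^{n\times n}_+.$$ Let $a_{ij},b_i,c\in L^\infty(\Omega)$ ($1\le i,j\le n$) satisfy, for some positive constants $\lambda,\Lambda$, $$|a_{ij}(x)|+|b_i(x)|+|c(x)|\le\Lambda,\qquad a_{ij}(x)\xi_i\xi_j\ge\lambda|\xi|^2\qquad\text{for all }x\in\Omega,\ \xi\in\mathbb{R}^n,$$ and let $f\in USC(\Omega)$. Assume that $u\in LSC(\Omega)$ satisfies, for some constant $C$, $$a_{ij}(x)\partial_{ij}u+b_i(x)\partial_iu+c(x)u\le C\quad\text{in }\Omega\text{ in the viscosity sense},$$ and, for some subset $E$ of $\Omega$ of zero Lebesgue measure, $$F(x,u,\nabla u,\nabla^2u)\le f(x)\quad\text{in }\Omega\setminus E\text{ in the viscosity sense}.$$ Then $$F(x,u,\nabla u,\nabla^2u)\le f(x)\quad\text{in }\Omega\text{ in the viscosity sense}.$$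
   Context: $\mathcal{S}^{n\times n}$ is the set of real symmetric $n\times n$ matrices and $\mathcal{S}^{n\times n}_+$ its subset of positive definite matrices. $LSC(\Omega)$, $USC(\Omega)$ are the sets of (real-valued) lower-/upper-semicontinuous functions on $\Omega$. Repeated indices are summed. The coefficients are bounded measurable functions defined at every point of $\Omega$. Viscosity sense: for $A\subset\Omega$ and $u\in LSC(\Omega)$, an inequality $G(x,u,\nabla u,\nabla^2u)\le g(x)$ holds in $A$ in the viscosity sense if whenever $x_0\in A$ and $\varphi$ is a $C^2$ function in a neighborhood of $x_0$ in $\Omega$ with $\varphi\le u$ in that neighborhood and $\varphi(x_0)=u(x_0)$, one has $G(x_0,\varphi(x_0),\nabla\varphi(x_0),\nabla^2\varphi(x_0))\le g(x_0)$. This applies both to $G=F$ and to the linear operator $G(x,s,p,M)=a_{ij}(x)M_{ij}+b_i(x)p_i+c(x)s$ (evaluated pointwise at $x_0$). *)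

theory Defs
  imports "HOL-Analysis.Analysis"
begin

definition symmetric_matrices :: "(real^'n^'n) set" where
  "symmetric_matrices = {M. transpose M = M}"

definition positive_definite_matrices :: "(real^'n^'n) set" where
  "positive_definite_matrices =
     {N \<in> symmetric_matrices. \<forall>\<xi>. \<xi> \<noteq> 0 \<longrightarrow> (N *v \<xi>) \<bullet> \<xi> > 0}"

definition lower_semicontinuous_on :: "'a::topological_space set \<Rightarrow> ('a \<Rightarrow> real) \<Rightarrow> bool" where
  "lower_semicontinuous_on S u \<longleftrightarrow>
     (\<forall>x\<in>S. \<forall>t<u x. eventually (\<lambda>y. t < u y) (at x within S))"

definition upper_semicontinuous_on :: "'a::topological_space set \<Rightarrow> ('a \<Rightarrow> real) \<Rightarrow> bool" where
  "upper_semicontinuous_on S u \<longleftrightarrow>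
     (\<forall>x\<in>S. \<forall>t>u x. eventually (\<lambda>y. u y < t) (at x within S))"

text \<open>
  The functions g and H are the gradient and the Hessian of the C^2 function \<phi> on the set U,
  which is meant to be open. The entry H x $ i $ j is the j-th partial derivative at x of the
  i-th component of g. Symmetry of H x is not imposed, since it follows from the continuity of H.
\<close>
definition C2_with_derivs ::
  "(real^'n) set \<Rightarrow> (real^'n \<Rightarrow> real) \<Rightarrow> (real^'n \<Rightarrow> real^'n) \<Rightarrow> (real^'n \<Rightarrow> real^'n^'n) \<Rightarrow> bool"
where
  "C2_with_derivs U \<phi> g H \<longleftrightarrow>
     (\<forall>x\<in>U. GDERIV \<phi> x :> g x) \<and>
     (\<forall>x\<in>U. (g has_derivative (\<lambda>h. H x *v h)) (at x)) \<and>
     continuous_on U H"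

text \<open>
  Differential operators G(x, s, p, M) are total functions on arbitrary square matrices M; only
  their values for x in the domain and M symmetric matter.
\<close>
type_synonym 'n operator = "real^'n \<Rightarrow> real \<Rightarrow> real^'n \<Rightarrow> real^'n^'n \<Rightarrow> real"

definition degenerate_elliptic :: "(real^'n) set \<Rightarrow> 'n operator \<Rightarrow> bool" where
  "degenerate_elliptic \<Omega> F \<longleftrightarrow>
     (\<forall>x\<in>\<Omega>. \<forall>s p. \<forall>M\<in>symmetric_matrices. \<forall>N\<in>positive_definite_matrices.
        F x s p (M + N) \<ge> F x s p M)"

definition linear_operator ::
  "(real^'n \<Rightarrow> real^'n^'n) \<Rightarrow> (real^'n \<Rightarrow> real^'n) \<Rightarrow> (real^'n \<Rightarrow> real) \<Rightarrow> 'n operator"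
where
  "linear_operator a b c x s p M =
     (\<Sum>i\<in>UNIV. \<Sum>j\<in>UNIV. a x $ i $ j * M $ i $ j) + (\<Sum>i\<in>UNIV. b x $ i * p $ i) + c x * s"

text \<open>
  G(x, u, Du, D^2 u) \<le> g in A in the viscosity sense, for A a subset of the open set \<Omega>.
\<close>
definition viscosity_le ::
  "(real^'n) set \<Rightarrow> 'n operator \<Rightarrow> (real^'n \<Rightarrow> real) \<Rightarrow> (real^'n \<Rightarrow> real) \<Rightarrow> (real^'n) set \<Rightarrow> bool"
where
  "viscosity_le \<Omega> G u g A \<longleftrightarrow>
     (\<forall>x\<^sub>0\<in>A. \<forall>U \<phi> D\<phi> H.
        open U \<and> x\<^sub>0 \<in> U \<and> U \<subseteq> \<Omega> \<and> C2_with_derivs U \<phi> D\<phi> H \<and>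
        (\<forall>x\<in>U. \<phi> x \<le> u x) \<and> \<phi> x\<^sub>0 = u x\<^sub>0
        \<longrightarrow> G x\<^sub>0 (\<phi> x\<^sub>0) (D\<phi> x\<^sub>0) (H x\<^sub>0) \<le> g x\<^sub>0)"

end

theory Submission
  imports Defs
begin

text \<open>
  Let \<phi> be a test function touching u from below at z; the inequality for F is wanted at z although z
  may lie in E. It suffices to find points x outside E, arbitrarily close to z, at which u is touched
  from below by a C^2 function whose value, gradient and Hessian at x are close to those of \<phi> at z:
  F is continuous, f is upper semicontinuous, and the inequality at the points x passes to the limit.

  The nearby test functions are affine perturbations of \<phi> - \<epsilon>|y - z|^2. Put
  w = u - \<phi> + \<epsilon>|y - z|^2, so that w(z) = 0 and w \<ge> \<epsilon>|y - z|^2. For every small slope p the function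
  w(y) - p \<bullet> (y - z) has a minimum point x on a ball around z, and |x - z| \<le> |p| / \<epsilon>. There
  w lies above an affine function of slope p that touches it at x, which means that u is touched at x
  by \<phi> - \<epsilon>|y - z|^2 plus an affine function. So the question is whether all these contact points can
  lie in the null set E.

  They cannot, because the linear inequality makes the slope a Lipschitz function of the contact
  point (lemma contact_slopes_close). A Lipschitz map sends null sets to null sets, whereas
  the slopes fill a ball. This is the mechanism of the Alexandrov-Bakelman-Pucci estimate; since
  only null sets matter, it is enough to compare two contact points at a time.

  The Lipschitz bound comes from a barrier. If the slopes at two contact points of distance at most r
  differ by q, then w, minus its tangent function at the first point, is nonnegative, vanishes at
  that point, and is at least |q| r at distance 2r in direction q/|q|. If |q|/r were large,
  a quadratic polynomial with second derivative of order |q|/r in direction q and a small negative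
  one in the other directions could be moved until it touches w from below, and ellipticity
  bounds the Hessian of such a polynomial.
\<close>

section \<open>Semicontinuous functions\<close>

text \<open>
  Without a minimum, every point of K has a neighbourhood in K on which w exceeds some other
  value of w. Among the values that belong to a finite subcover, the smallest one contradicts this.
\<close>

lemma lower_semicontinuous_attains_min:
  fixes w :: "'a::topological_space \<Rightarrow> real"
  assumes K: "compact K" "K \<noteq> {}" and lsc: "lower_semicontinuous_on K w"
  shows "\<exists>x\<in>K. \<forall>y\<in>K. w x \<le> w y"
proof (rule ccontr)
  assume "\<not> ?thesis"
  then have "\<forall>x\<in>K. \<exists>z\<in>K. w z < w x" by (auto simp: not_le)
  then obtain z where z: "\<And>x. x \<in> K \<Longrightarrow> z x \<in> K \<and> w (z x) < w x" by metis
  have "\<exists>V. open V \<and> x \<in> V \<and> (\<forall>y\<in>V \<inter> K. w (z x) < w y)" if "x \<in> K" for x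
  proof -
    have "eventually (\<lambda>y. w (z x) < w y) (at x within K)"
      using lsc z[OF that] that unfolding lower_semicontinuous_on_def by blast
    then obtain V where "open V" "x \<in> V" "\<forall>y\<in>V. y \<noteq> x \<longrightarrow> y \<in> K \<longrightarrow> w (z x) < w y"
      unfolding eventually_at_topological by blast
    then show ?thesis using z[OF that] by (intro exI[of _ V]) auto
  qed
  then obtain V where V: "\<And>x. x \<in> K \<Longrightarrow> open (V x) \<and> x \<in> V x \<and> (\<forall>y\<in>V x \<inter> K. w (z x) < w y)"
    by metis
  obtain C where C: "C \<subseteq> K" "finite C" "K \<subseteq> (\<Union>c\<in>C. V c)"
    by (rule compactE_image[OF K(1), of K V]) (use V in auto)
  have "C \<noteq> {}" using C(3) K(2) by auto
  obtain m where m: "m \<in> C" "\<And>c. c \<in> C \<Longrightarrow> w (z m) \<le> w (z c)"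
    using finite_imageI[OF C(2), of "\<lambda>c. w (z c)"] \<open>C \<noteq> {}\<close> C(2)
    by (metis arg_min_if_finite(1) arg_min_least)
  have "z m \<in> K" using z C(1) m(1) by blast
  then obtain c where c: "c \<in> C" "z m \<in> V c" using C(3) by blast
  then have "w (z c) < w (z m)" using V C(1) \<open>z m \<in> K\<close> by blast
  with m(2)[OF c(1)] show False by simp
qed

lemma lower_semicontinuous_on_diff:
  assumes "lower_semicontinuous_on S w" "continuous_on S h"
  shows "lower_semicontinuous_on S (\<lambda>y. w y - h y)"
  unfolding lower_semicontinuous_on_def
proof (intro ballI allI impI)
  fix x t assume x: "x \<in> S" "t < w x - h x"
  define d where "d = (w x - h x - t) / 2"
  have d: "d > 0" using x(2) by (simp add: d_def)
  have "eventually (\<lambda>y. w x - d < w y) (at x within S)"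
    using assms(1) x(1) d unfolding lower_semicontinuous_on_def by simp
  moreover have "eventually (\<lambda>y. h y < h x + d) (at x within S)"
    using assms(2) x(1) d by (intro order_tendstoD(2)[of _ "h x"]) (auto simp: continuous_on)
  ultimately show "eventually (\<lambda>y. t < w y - h y) (at x within S)"
    by eventually_elim (simp add: d_def field_simps)
qed

lemma lower_semicontinuous_on_subset:
  "lower_semicontinuous_on S w \<Longrightarrow> T \<subseteq> S \<Longrightarrow> lower_semicontinuous_on T w"
  unfolding lower_semicontinuous_on_def using filter_leD[OF at_le] by blast

section \<open>C^2 functions\<close>

lemma C2_with_derivs_continuous_on:
  assumes "C2_with_derivs U \<phi> g H"
  shows "continuous_on U \<phi>" "continuous_on U g" "continuous_on U H"
  using assms unfolding C2_with_derivs_def gderiv_def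
  by (auto intro!: continuous_at_imp_continuous_on has_derivative_continuous)

lemma C2_with_derivs_subset:
  assumes "C2_with_derivs U \<phi> g H" "V \<subseteq> U" shows "C2_with_derivs V \<phi> g H"
  using assms continuous_on_subset unfolding C2_with_derivs_def by blast

lemma C2_with_derivs_add:
  assumes "C2_with_derivs U \<phi> g H" "C2_with_derivs U \<psi> k G"
  shows "C2_with_derivs U (\<lambda>x. \<phi> x + \<psi> x) (\<lambda>x. g x + k x) (\<lambda>x. H x + G x)"
proof -
  have "((\<lambda>x. g x + k x) has_derivative (\<lambda>h. (H x + G x) *v h)) (at x)" if "x \<in> U" for x
    unfolding matrix_vector_mult_add_rdistrib
    using assms that unfolding C2_with_derivs_def by (intro has_derivative_add) auto
  then show ?thesis
    using assms unfolding C2_with_derivs_def by (auto intro!: GDERIV_add continuous_on_add)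
qed

text \<open>
  One family of polynomials serves as penalty, as affine perturbation and as barrier. In the barrier,
  the first term is convex in the unit direction e and vanishes on the hyperplane at signed distance
  -r from z.
\<close>

definition quadratic :: "real \<Rightarrow> real \<Rightarrow> real \<Rightarrow> real^'n \<Rightarrow> real^'n \<Rightarrow> real \<Rightarrow> real^'n \<Rightarrow> real^'n \<Rightarrow> real"
  where "quadratic A r B e p k z y =
    A * ((y - z) \<bullet> e + r)\<^sup>2 - B * (norm (y - z))\<^sup>2 + p \<bullet> (y - z) + k"

definition quadratic_gradient :: "real \<Rightarrow> real \<Rightarrow> real \<Rightarrow> real^'n \<Rightarrow> real^'n \<Rightarrow> real^'n \<Rightarrow> real^'n \<Rightarrow> real^'n"
  where "quadratic_gradient A r B e p z y =
    (2 * A * ((y - z) \<bullet> e + r)) *\<^sub>R e - (2 * B) *\<^sub>R (y - z) + p"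

definition rank_one :: "real^'n \<Rightarrow> real^'n^'n"
  where "rank_one e = (\<chi> i j. e $ i * e $ j)"

definition quadratic_hessian :: "real \<Rightarrow> real \<Rightarrow> real^'n \<Rightarrow> real^'n^'n"
  where "quadratic_hessian A B e = (2 * A) *\<^sub>R rank_one e - (2 * B) *\<^sub>R mat 1"

lemma quadratic_hessian_mult:
  "quadratic_hessian A B e *v h = (2 * A * (h \<bullet> e)) *\<^sub>R e - (2 * B) *\<^sub>R h"
proof -
  have "(\<Sum>j\<in>UNIV. (2 * A * e $ i * e $ j - (if i = j then 2 * B else 0)) * h $ j)
      = 2 * A * (h \<bullet> e) * e $ i - 2 * B * h $ i" for i
  proof -
    have "(2 * A * e $ i * e $ j - (if i = j then 2 * B else 0)) * h $ j
        = 2 * A * e $ i * (h $ j * e $ j) - (if i = j then 2 * B * h $ j else 0)" for j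
      by (simp add: left_diff_distrib)
    then show ?thesis
      by (simp add: sum_subtractf sum_distrib_left[symmetric] inner_vec_def)
  qed
  then show ?thesis
    by (simp add: vec_eq_iff matrix_vector_mult_def quadratic_hessian_def rank_one_def mat_def
        mult.assoc if_distrib cong: if_cong)
qed

lemma C2_with_derivs_quadratic:
  "C2_with_derivs U (quadratic A r B e p k z) (quadratic_gradient A r B e p z)
     (\<lambda>_. quadratic_hessian A B e)"
proof -
  have "GDERIV (quadratic A r B e p k z) x :> quadratic_gradient A r B e p z x" for x
    unfolding gderiv_def quadratic_def[abs_def] quadratic_gradient_def power2_norm_eq_inner
    by (auto intro!: derivative_eq_intros simp: fun_eq_iff algebra_simps inner_commute)
  moreover have "(quadratic_gradient A r B e p z has_derivative
      (\<lambda>h. quadratic_hessian A B e *v h)) (at x)" for x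
    unfolding quadratic_hessian_mult quadratic_gradient_def[abs_def]
    by (auto intro!: derivative_eq_intros simp: fun_eq_iff algebra_simps)
  ultimately show ?thesis unfolding C2_with_derivs_def by auto
qed

text \<open>
  The mean value theorem is applied to the first difference in direction h, then to the
  gradient in direction k. The left-hand side is symmetric in h and k, which is what
  makes the Hessian symmetric.
\<close>

lemma second_difference_eq_hessian:
  fixes \<phi> :: "real^'n \<Rightarrow> real"
  assumes C2: "C2_with_derivs U \<phi> g H"
    and par: "\<And>s t. 0 \<le> s \<Longrightarrow> s \<le> 1 \<Longrightarrow> 0 \<le> t \<Longrightarrow> t \<le> 1 \<Longrightarrow> x + s *\<^sub>R h + t *\<^sub>R k \<in> U"
  shows "\<exists>s t. 0 < s \<and> s < 1 \<and> 0 < t \<and> t < 1 \<and>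
    \<phi> (x + h + k) - \<phi> (x + h) - \<phi> (x + k) + \<phi> x = h \<bullet> (H (x + s *\<^sub>R h + t *\<^sub>R k) *v k)"
proof -
  have d\<phi>: "(\<phi> has_derivative (\<lambda>h. h \<bullet> g y)) (at y)" if "y \<in> U" for y
    using C2 that by (auto simp: C2_with_derivs_def gderiv_def)
  have dg: "(g has_derivative (\<lambda>h. H y *v h)) (at y)" if "y \<in> U" for y
    using C2 that by (auto simp: C2_with_derivs_def)
  define G where "G s = \<phi> (x + s *\<^sub>R h + k) - \<phi> (x + s *\<^sub>R h)" for s
  have "DERIV G s :> h \<bullet> (g (x + s *\<^sub>R h + k) - g (x + s *\<^sub>R h))" if "0 \<le> s" "s \<le> 1" for s
  proof -
    have "x + s *\<^sub>R h + k \<in> U" "x + s *\<^sub>R h \<in> U" using par[of s 1] par[of s 0] that by auto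
    moreover have "((\<lambda>s. x + s *\<^sub>R h + k) has_derivative (\<lambda>t. t *\<^sub>R h)) (at s)"
      "((\<lambda>s. x + s *\<^sub>R h) has_derivative (\<lambda>t. t *\<^sub>R h)) (at s)"
      by (auto intro!: derivative_eq_intros)
    ultimately have "(G has_derivative
        (\<lambda>t. (t *\<^sub>R h) \<bullet> g (x + s *\<^sub>R h + k) - (t *\<^sub>R h) \<bullet> g (x + s *\<^sub>R h))) (at s)"
      unfolding G_def[abs_def] using d\<phi>
      by (intro has_derivative_diff has_derivative_compose[where g = \<phi> and f = "\<lambda>s. x + s *\<^sub>R h + k"]
          has_derivative_compose[where g = \<phi> and f = "\<lambda>s. x + s *\<^sub>R h"])
    then show ?thesis unfolding has_field_derivative_def
      by (rule has_derivative_eq_rhs) (auto simp: fun_eq_iff algebra_simps)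
  qed
  then obtain s where s: "0 < s" "s < 1"
    "G 1 - G 0 = (1 - 0) * (h \<bullet> (g (x + s *\<^sub>R h + k) - g (x + s *\<^sub>R h)))"
    using MVT2[of 0 1 G "\<lambda>s. h \<bullet> (g (x + s *\<^sub>R h + k) - g (x + s *\<^sub>R h))"] by auto
  define L where "L t = h \<bullet> g (x + s *\<^sub>R h + t *\<^sub>R k)" for t
  have "DERIV L t :> h \<bullet> (H (x + s *\<^sub>R h + t *\<^sub>R k) *v k)" if "0 \<le> t" "t \<le> 1" for t
  proof -
    have "x + s *\<^sub>R h + t *\<^sub>R k \<in> U" using par s that by auto
    moreover have "((\<lambda>t. x + s *\<^sub>R h + t *\<^sub>R k) has_derivative (\<lambda>t. t *\<^sub>R k)) (at t)"
      by (auto intro!: derivative_eq_intros)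
    ultimately have "(L has_derivative
        (\<lambda>r. h \<bullet> (H (x + s *\<^sub>R h + t *\<^sub>R k) *v (r *\<^sub>R k)))) (at t)"
      unfolding L_def[abs_def] using dg
      by (intro has_derivative_inner_right
          has_derivative_compose[where g = g and f = "\<lambda>t. x + s *\<^sub>R h + t *\<^sub>R k"])
    then show ?thesis unfolding has_field_derivative_def
      by (rule has_derivative_eq_rhs) (auto simp: fun_eq_iff matrix_vector_mult_scaleR algebra_simps)
  qed
  then obtain t where t: "0 < t" "t < 1"
    "L 1 - L 0 = (1 - 0) * (h \<bullet> (H (x + s *\<^sub>R h + t *\<^sub>R k) *v k))"
    using MVT2[of 0 1 L "\<lambda>t. h \<bullet> (H (x + s *\<^sub>R h + t *\<^sub>R k) *v k)"] by auto
  have "\<phi> (x + h + k) - \<phi> (x + h) - \<phi> (x + k) + \<phi> x = G 1 - G 0" by (simp add: G_def)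
  also have "\<dots> = L 1 - L 0" using s(3) by (simp add: L_def inner_diff_right)
  finally show ?thesis using s(1,2) t by auto
qed

text \<open>
  The operator F is continuous only on symmetric matrices, so the Hessians of the test functions
  must be known to be symmetric before the limit in F can be taken.
\<close>

lemma C2_hessian_symmetric:
  fixes \<phi> :: "real^'n \<Rightarrow> real"
  assumes C2: "C2_with_derivs U \<phi> g H" and U: "open U" "x \<in> U"
  shows "H x \<in> symmetric_matrices"
proof -
  have "H x $ i $ j = H x $ j $ i" for i j
  proof (rule ccontr)
    let ?h = "axis i (1::real)" and ?k = "axis j (1::real)"
    assume ne: "H x $ i $ j \<noteq> H x $ j $ i"
    define m where "m = \<bar>H x $ i $ j - H x $ j $ i\<bar> / 2"
    have "m > 0" using ne by (simp add: m_def)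
    have "continuous (at x) H"
      using C2 U by (simp add: C2_with_derivs_def continuous_on_eq_continuous_at)
    then obtain d where d: "d > 0" "\<And>y. dist y x < d \<Longrightarrow> dist (H y) (H x) < m"
      using \<open>m > 0\<close> unfolding continuous_at_eps_delta by blast
    obtain d' where d': "d' > 0" "ball x d' \<subseteq> U" using U openE by blast
    define t where "t = min d d' / 3"
    have t: "t > 0" "3 * t \<le> d" "3 * t \<le> d'" using d d' by (auto simp: t_def)
    have near: "dist (x + a *\<^sub>R (t *\<^sub>R axis i' 1) + b *\<^sub>R (t *\<^sub>R axis j' 1)) x < 3 * t"
      if "0 \<le> a" "a \<le> 1" "0 \<le> b" "b \<le> 1" for a b :: real and i' j' :: 'n
    proof -
      have "dist (x + a *\<^sub>R (t *\<^sub>R axis i' 1) + b *\<^sub>R (t *\<^sub>R axis j' 1)) x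
          \<le> norm (a *\<^sub>R (t *\<^sub>R axis i' (1::real))) + norm (b *\<^sub>R (t *\<^sub>R axis j' (1::real)))"
        using norm_triangle_ineq[of "a *\<^sub>R (t *\<^sub>R axis i' (1::real))" "b *\<^sub>R (t *\<^sub>R axis j' (1::real))"]
        by (simp add: dist_norm add.assoc)
      also have "\<dots> \<le> 1 * t + 1 * t" using that t
        by (intro add_mono) (auto simp: mult_right_mono)
      finally show ?thesis using t by simp
    qed
    have entry: "axis i' 1 \<bullet> (M *v axis j' 1) = M $ i' $ j'" for M :: "real^'n^'n" and i' j' :: 'n
      by (simp add: inner_axis' matrix_vector_mult_basis column_def)
    \<comment> \<open>Both mixed entries are realised, at points near x, by the same second difference of \<phi>.\<close>
    have main: "\<exists>y. dist y x < d \<and> \<phi> (x + t *\<^sub>R axis i' 1 + t *\<^sub>R axis j' 1)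
        - \<phi> (x + t *\<^sub>R axis i' 1) - \<phi> (x + t *\<^sub>R axis j' 1) + \<phi> x = t * t * H y $ i' $ j'" for i' j'
    proof -
      have par: "x + a *\<^sub>R (t *\<^sub>R axis i' 1) + b *\<^sub>R (t *\<^sub>R axis j' 1) \<in> U"
        if "0 \<le> a" "a \<le> 1" "0 \<le> b" "b \<le> 1" for a b
        using near[OF that, of i' j'] t(3) d'(2) by (auto simp: dist_commute subset_iff)
      obtain a b where ab: "0 < a" "a < 1" "0 < b" "b < 1" 
        "\<phi> (x + t *\<^sub>R axis i' 1 + t *\<^sub>R axis j' 1)
        - \<phi> (x + t *\<^sub>R axis i' 1) - \<phi> (x + t *\<^sub>R axis j' 1) + \<phi> x = 
         (t *\<^sub>R axis i' 1) \<bullet> (H (x + a *\<^sub>R (t *\<^sub>R axis i' 1) + b *\<^sub>R (t *\<^sub>R axis j' 1)) *v (t *\<^sub>R axis j' 1))"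
        using second_difference_eq_hessian[OF C2 par] by blast
      then show ?thesis using near[of a b i' j'] t
        by (intro exI[of _ "x + a *\<^sub>R (t *\<^sub>R axis i' 1) + b *\<^sub>R (t *\<^sub>R axis j' 1)"])
           (simp add: entry matrix_vector_mult_scaleR)
    qed
    let ?D = "\<phi> (x + t *\<^sub>R ?h + t *\<^sub>R ?k) - \<phi> (x + t *\<^sub>R ?h) - \<phi> (x + t *\<^sub>R ?k) + \<phi> x"
    obtain y where y: "dist y x < d" "?D = t * t * H y $ i $ j" using main[of i j] by blast
    have swap: "x + t *\<^sub>R ?k + t *\<^sub>R ?h = x + t *\<^sub>R ?h + t *\<^sub>R ?k" by (simp add: add_ac)
    obtain y' where y': "dist y' x < d" "\<phi> (x + t *\<^sub>R ?h + t *\<^sub>R ?k) - \<phi> (x + t *\<^sub>R ?k)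
        - \<phi> (x + t *\<^sub>R ?h) + \<phi> x = t * t * H y' $ j $ i"
      using main[of j i] unfolding swap by blast
    have comp: "\<bar>H z $ i' $ j' - H x $ i' $ j'\<bar> < m" if "dist z x < d" for z i' j'
    proof -
      have "\<bar>H z $ i' $ j' - H x $ i' $ j'\<bar> \<le> norm (H z - H x)"
        using component_le_norm_cart[of "(H z - H x) $ i'" j'] Finite_Cartesian_Product.norm_nth_le[of "H z - H x" i'] by simp
      then show ?thesis using d(2)[OF that] by (simp add: dist_norm)
    qed
    have "t * t * H y $ i $ j = t * t * H y' $ j $ i" using y(2) y'(2) by linarith
    then have "H y $ i $ j = H y' $ j $ i" using t(1) by simp
    then have "\<bar>H x $ i $ j - H x $ j $ i\<bar> < m + m"
      using comp[OF y(1), of i j] comp[OF y'(1), of j i] by linarith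
    then show False by (simp add: m_def)
  qed
  then show ?thesis by (simp add: symmetric_matrices_def vec_eq_iff transpose_def)
qed

section \<open>Reduction to the second-order part\<close>

lemma norm_matrix_le:
  fixes M :: "real^'n^'m"
  assumes "\<And>i j. \<bar>M $ i $ j\<bar> \<le> B"
  shows "norm M \<le> real CARD('m) * real CARD('n) * B"
proof -
  have row: "norm (M $ i) \<le> real CARD('n) * B" for i
    using norm_le_l1_cart[of "M $ i"] sum_bounded_above[of UNIV "\<lambda>j. \<bar>M $ i $ j\<bar>" B] assms by force
  have "norm M \<le> (\<Sum>i\<in>UNIV. norm (M $ i))" unfolding norm_vec_def by (rule L2_set_le_sum) simp
  also have "\<dots> \<le> real CARD('m) * (real CARD('n) * B)"
    using sum_bounded_above[of UNIV "\<lambda>i. norm (M $ i)"] row by force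
  finally show ?thesis by (simp add: mult.assoc)
qed

lemma linear_operator_inner:
  "linear_operator a b c x s p M = a x \<bullet> M + b x \<bullet> p + c x * s"
  by (simp add: linear_operator_def inner_vec_def)

text \<open>
  Lower-order terms are harmless as long as the value and the gradient of the test function stay
  bounded. Setting the operator to 0 for all other jets turns a bound for its second-order part on test
  functions with bounded jets into an ordinary viscosity inequality with a nonnegative right-hand side.
\<close>

definition truncated_operator :: "(real^'n \<Rightarrow> real^'n^'n) \<Rightarrow> real \<Rightarrow> 'n operator"
  where "truncated_operator a S x s p M = (if \<bar>s\<bar> \<le> S \<and> norm p \<le> S then a x \<bullet> M else 0)"

text \<open>
  If \<psi> touches u - \<phi> from below, then \<phi> + \<psi> touches u. All terms of the linear inequality for
  \<phi> + \<psi> other than the second-order part of \<psi> are bounded on a compact ball and go into K.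
\<close>

lemma supersolution_minus_C2:
  fixes u :: "real^'n \<Rightarrow> real"
  assumes visc: "viscosity_le \<Omega> (linear_operator a b c) u (\<lambda>_. C) \<Omega>"
    and coeff: "\<And>x. x \<in> \<Omega> \<Longrightarrow> norm (a x) \<le> \<kappa> \<and> norm (b x) \<le> \<kappa> \<and> \<bar>c x\<bar> \<le> \<kappa>"
    and C2: "C2_with_derivs V \<phi> g H" and V: "cball z \<rho> \<subseteq> V" "V \<subseteq> \<Omega>"
  shows "\<exists>K\<ge>0. viscosity_le (ball z \<rho>) (truncated_operator a S) (\<lambda>y. u y - \<phi> y) (\<lambda>_. K) (ball z \<rho>)"
proof -
  note cont = C2_with_derivs_continuous_on[OF C2]
  have bdd: "\<exists>B. \<forall>y\<in>cball z \<rho>. norm (h y) \<le> B" if "continuous_on V h"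
    for h :: "real^'n \<Rightarrow> 'b::real_normed_vector"
    using compact_imp_bounded[OF compact_continuous_image[OF continuous_on_subset[OF that V(1)] compact_cball]]
    unfolding bounded_iff by auto
  obtain B0 B1 B2 where B: "\<And>y. y \<in> cball z \<rho> \<Longrightarrow> norm (\<phi> y) \<le> B0"
    "\<And>y. y \<in> cball z \<rho> \<Longrightarrow> norm (g y) \<le> B1" "\<And>y. y \<in> cball z \<rho> \<Longrightarrow> norm (H y) \<le> B2"
    using bdd[OF cont(1)] bdd[OF cont(2)] bdd[OF cont(3)] by metis
  define K where "K = \<bar>C + \<kappa> * B2 + \<kappa> * (B1 + S) + \<kappa> * (B0 + S)\<bar>"
  have "a y \<bullet> M \<le> K" 
    if y: "y \<in> ball z \<rho>" and U: "open U" "y \<in> U" "U \<subseteq> ball z \<rho>" and C2': "C2_with_derivs U \<psi> k G"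
      and touch: "\<forall>x\<in>U. \<psi> x \<le> u x - \<phi> x" "\<psi> y = u y - \<phi> y" and small: "\<bar>\<psi> y\<bar> \<le> S" "norm (k y) \<le> S"
      and M: "M = G y"
    for y U \<psi> k G M
  proof -
    have yO: "y \<in> cball z \<rho>" "y \<in> \<Omega>" using y subset_trans[OF V] by (auto simp: subset_iff)
    have "C2_with_derivs U (\<lambda>x. \<phi> x + \<psi> x) (\<lambda>x. g x + k x) (\<lambda>x. H x + G x)"
      using subset_trans[OF U(3) subset_trans[OF ball_subset_cball V(1)]]
      by (intro C2_with_derivs_add C2' C2_with_derivs_subset[OF C2])
    moreover have "\<forall>x\<in>U. \<phi> x + \<psi> x \<le> u x" "\<phi> y + \<psi> y = u y" using touch by auto
    moreover have "U \<subseteq> \<Omega>"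
      using subset_trans[OF U(3) subset_trans[OF ball_subset_cball subset_trans[OF V]]] .
    ultimately have "linear_operator a b c y (\<phi> y + \<psi> y) (g y + k y) (H y + G y) \<le> C"
      using visc yO(2) U(1,2) unfolding viscosity_le_def by blast
    then have "a y \<bullet> M \<le> C - a y \<bullet> H y - b y \<bullet> (g y + k y) - c y * (\<phi> y + \<psi> y)"
      by (simp add: linear_operator_inner inner_add_right M)
    moreover have "\<bar>a y \<bullet> H y\<bar> \<le> \<kappa> * B2"
      using Cauchy_Schwarz_ineq2[of "a y" "H y"] mult_mono'[of "norm (a y)" \<kappa> "norm (H y)" B2]
        coeff[OF yO(2)] B(3)[OF yO(1)] by force
    moreover have "\<bar>b y \<bullet> (g y + k y)\<bar> \<le> \<kappa> * (B1 + S)"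
    proof -
      have "norm (g y + k y) \<le> B1 + S" using norm_triangle_ineq[of "g y" "k y"] B(2)[OF yO(1)] small(2) by linarith
      then show ?thesis
        using Cauchy_Schwarz_ineq2[of "b y" "g y + k y"] mult_mono'[of "norm (b y)" \<kappa> "norm (g y + k y)" "B1 + S"]
          coeff[OF yO(2)] by force
    qed
    moreover have "\<bar>c y * (\<phi> y + \<psi> y)\<bar> \<le> \<kappa> * (B0 + S)"
      unfolding abs_mult using coeff[OF yO(2)] B(1)[OF yO(1)] small(1) by (intro mult_mono') auto
    ultimately show ?thesis unfolding K_def by linarith
  qed
  moreover have "0 \<le> K" by (simp add: K_def)
  ultimately show ?thesis
    unfolding viscosity_le_def truncated_operator_def by (intro exI[of _ K]) auto
qed

section \<open>Slopes at contact points\<close>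

text \<open>
  Write q for p' - p, e for q/|q|, t for (y - x) \<bullet> e, and l for the affine function touching
  w at x. The two contact conditions give w - l \<ge> max 0 (|q| (t - r)). The barrier
  A (t + r)^2 - B |y - x|^2 is positive at x, but it does not exceed this lower bound on the boundary
  of the part t \<ge> -r of the ball of radius N r around x. So w - l minus the barrier has an interior
  minimum, where the equation bounds the Hessian of the barrier: 2 A lam minus a multiple of B is at
  most K. With B small compared with A and A of order |q|/r this is the claim.
\<close>

lemma contact_slopes_close:
  fixes w :: "real^'n \<Rightarrow> real" and a :: "real^'n \<Rightarrow> real^'n^'n"
  assumes lsc: "lower_semicontinuous_on (ball z \<rho>) w"
    and visc: "viscosity_le (ball z \<rho>) (truncated_operator a 5) w (\<lambda>_. K) (ball z \<rho>)" and K: "K \<ge> 0"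
    and ell: "\<And>y \<xi>. y \<in> ball z \<rho> \<Longrightarrow> lam * (norm \<xi>)\<^sup>2 \<le> a y \<bullet> rank_one \<xi>" and lam: "lam > 0"
    and coeff: "\<And>y. y \<in> ball z \<rho> \<Longrightarrow> norm (a y) \<le> \<kappa>"
    and N: "N \<ge> 4" "32 * \<kappa> * norm (mat 1 :: real^'n^'n) \<le> lam * N\<^sup>2"
    and r: "r > 0" "N * r \<le> 1" "cball x (N * r) \<subseteq> ball z \<rho>" "norm (x' - x) \<le> r"
    and contact: "\<And>y. y \<in> ball z \<rho> \<Longrightarrow> w x + p \<bullet> (y - x) \<le> w y"
    and contact': "\<And>y. y \<in> ball z \<rho> \<Longrightarrow> w x' + p' \<bullet> (y - x') \<le> w y"
    and bounds: "\<bar>w x\<bar> \<le> 1" "norm p \<le> 1" "norm p' \<le> 1"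
  shows "norm (p' - p) \<le> 2 * (N + 1) * K / lam * r"
proof (cases "p' = p")
  case True
  then show ?thesis using K lam N r by simp
next
  case False
  define q where "q = norm (p' - p)"
  define e where "e = (p' - p) /\<^sub>R q"
  \<comment> \<open>A is the largest value with A (t + r)^2 \<le> |q| (t + r) / 2 on the ball of radius N r, so that the
    barrier stays below |q| (t - r) once t \<ge> 3 r. B is chosen so that B |y - x|^2 = A (4 r)^2 on the
    sphere of radius N r, which makes the barrier nonpositive on the sphere where -r \<le> t \<le> 3 r.\<close>
  define A where "A = q / (2 * (N + 1) * r)"
  define B where "B = 16 * A / N\<^sup>2"
  have q: "q > 0" "q \<le> 2"
    using False bounds norm_triangle_ineq4[of p' p] by (auto simp: q_def)
  have e: "norm e = 1" "p' - p = q *\<^sub>R e" using q(1) by (simp_all add: e_def q_def)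
  have A: "A > 0" "2 * A * ((N + 1) * r) = q"
  proof -
    have "(N + 1) * r > 0" using N r by simp
    moreover have "A = q / (2 * ((N + 1) * r))" unfolding A_def by (simp only: mult.assoc)
    moreover have "q / (2 * s) > 0" "2 * (q / (2 * s)) * s = q" if "s > 0" for s
      using that q by auto
    ultimately show "A > 0" "2 * A * ((N + 1) * r) = q" by metis+
  qed
  have B: "B > 0" "B * N\<^sup>2 = 16 * A" using A N by (auto simp: B_def)
  have xr: "x \<in> ball z \<rho>" using r(3) mult_nonneg_nonneg[of N r] N r(1) by (auto simp: subset_iff)
  have x': "x' \<in> ball z \<rho>" 
  proof -
    have "1 * r \<le> N * r" using N r by (intro mult_right_mono) auto
    then have "x' \<in> cball x (N * r)" using r(4) by (simp add: dist_norm norm_minus_commute)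
    then show ?thesis using r(3) by blast
  qed
  define Q where "Q = quadratic A r B e p (w x) x"
  define D where "D = cball x (N * r) \<inter> {y. - r \<le> (y - x) \<bullet> e}"
  have Q: "Q y = A * ((y - x) \<bullet> e + r)\<^sup>2 - B * (norm (y - x))\<^sup>2 + p \<bullet> (y - x) + w x" for y
    by (simp add: Q_def quadratic_def)
  have te: "\<bar>(y - x) \<bullet> e\<bar> \<le> norm (y - x)" for y
    using Cauchy_Schwarz_ineq2[of "y - x" e] e(1) by simp
  have above: "q * ((y - x) \<bullet> e - r) \<le> w y - w x - p \<bullet> (y - x)" if "y \<in> ball z \<rho>" for y
  proof -
    have "(p' - p) \<bullet> (x' - x) \<le> q * r"
      using norm_cauchy_schwarz[of "p' - p" "x' - x"] mult_left_mono[OF r(4), of q] q(1)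
      unfolding q_def[symmetric] by linarith
    moreover have "(p' - p) \<bullet> (y - x) = q * ((y - x) \<bullet> e)" by (simp add: e(2) inner_commute)
    moreover have "w x' + p' \<bullet> (y - x') \<le> w y" "w x + p \<bullet> (x' - x) \<le> w x'"
      using contact' contact that x' by auto
    ultimately show ?thesis by (simp add: algebra_simps)
  qed
  have D: "compact D" "x \<in> D" "D \<subseteq> ball z \<rho>"
  proof -
    have "closed {y. - r \<le> (y - x) \<bullet> e}" by (intro closed_Collect_le continuous_intros)
    then show "compact D" unfolding D_def by (intro compact_Int_closed compact_cball)
    show "x \<in> D" using r N by (simp add: D_def)
    show "D \<subseteq> ball z \<rho>" using r(3) by (auto simp: D_def)
  qed
  have "continuous_on D Q"
    unfolding Q_def by (rule C2_with_derivs_continuous_on(1)[OF C2_with_derivs_quadratic])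
  then have "lower_semicontinuous_on D (\<lambda>y. w y - Q y)"
    by (intro lower_semicontinuous_on_diff lower_semicontinuous_on_subset[OF lsc D(3)])
  then obtain y where y: "y \<in> D" "\<And>y'. y' \<in> D \<Longrightarrow> w y - Q y \<le> w y' - Q y'"
    using lower_semicontinuous_attains_min[OF D(1)] D(2) by blast
  define m where "m = w y - Q y"
  define t where "t = (y - x) \<bullet> e"
  have yb: "y \<in> ball z \<rho>" using y(1) D(3) by auto
  have yN: "norm (y - x) \<le> N * r" "- r \<le> t"
    using y(1) by (auto simp: D_def t_def dist_norm norm_minus_commute)
  have tN: "t + r \<le> (N + 1) * r" using te[of y] yN(1) by (simp add: t_def algebra_simps)
  have "m \<le> w x - Q x" using y(2)[OF D(2)] by (simp add: m_def)
  also have "\<dots> < 0" using A r by (simp add: Q)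
  finally have m: "m < 0" .
  have lt: "w y - w x - p \<bullet> (y - x) < A * (t + r)\<^sup>2 - B * (norm (y - x))\<^sup>2"
    using m by (simp add: m_def Q t_def)
  then have pos: "0 < A * (t + r)\<^sup>2 - B * (norm (y - x))\<^sup>2" using contact[OF yb] by simp
  \<comment> \<open>The minimum lies neither on the flat part nor on the spherical part of the boundary of D.\<close>
  have t1: "- r < t"
  proof (rule ccontr)
    assume "\<not> - r < t"
    then have "t + r = 0" using yN by simp
    moreover have "0 \<le> B * (norm (y - x))\<^sup>2" using B by simp
    ultimately show False using pos by simp
  qed
  have Asq: "A * (t + r)\<^sup>2 \<le> q / 2 * (t + r)"
  proof -
    have "A * (t + r) * (t + r) \<le> A * ((N + 1) * r) * (t + r)"
      using A tN t1 by (intro mult_right_mono mult_left_mono) auto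
    also have "A * ((N + 1) * r) = q / 2" using A(2) by linarith
    finally show ?thesis by (simp add: power2_eq_square)
  qed
  have y1: "norm (y - x) < N * r"
  proof (rule ccontr)
    assume "\<not> ?thesis"
    then have eq: "norm (y - x) = N * r" using yN by simp
    have Beq: "B * (norm (y - x))\<^sup>2 = A * (4 * r)\<^sup>2"
      using B(2) by (simp add: eq power_mult_distrib)
    show False
    proof (cases "t \<le> 3 * r")
      case True
      have "(t + r)\<^sup>2 \<le> (4 * r)\<^sup>2" using True t1 by (intro power_mono) auto
      then have "A * (t + r)\<^sup>2 \<le> A * (4 * r)\<^sup>2" using A by simp
      then show False using pos Beq by simp
    next
      case False
      have "q * (t - r) < A * (t + r)\<^sup>2"
      proof -
        have "0 \<le> B * (norm (y - x))\<^sup>2" using B by simp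
        then show ?thesis using lt above[OF yb, folded t_def] by linarith
      qed
      then have "q * (t - r) < q / 2 * (t + r)" using Asq by simp
      moreover have "q * ((t + r) / 2) \<le> q * (t - r)" using False q by (intro mult_left_mono) auto
      ultimately show False by simp
    qed
  qed
  define U where "U = ball x (N * r) \<inter> {y. - r < (y - x) \<bullet> e}"
  have U: "open U" "y \<in> U" "U \<subseteq> D" "U \<subseteq> ball z \<rho>"
  proof -
    show "open U" unfolding U_def by (intro open_Int open_ball open_Collect_less continuous_intros)
    show "y \<in> U" using y1 t1 by (simp add: U_def t_def dist_norm norm_minus_commute)
    show "U \<subseteq> D" by (auto simp: U_def D_def)
    then show "U \<subseteq> ball z \<rho>" using D(3) by simp
  qed
  define P where "P = quadratic A r B e p (w x + m) x"
  have P: "P y' = Q y' + m" for y' by (simp add: P_def Q_def quadratic_def)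
  have touch: "\<forall>y'\<in>U. P y' \<le> w y'" "P y = w y"
  proof -
    have "P y' \<le> w y'" if "y' \<in> U" for y'
      using y(2)[of y'] that U(3) by (auto simp: P m_def algebra_simps)
    then show "\<forall>y'\<in>U. P y' \<le> w y'" by blast
    show "P y = w y" by (simp add: P m_def)
  qed
  have py: "\<bar>p \<bullet> (y - x)\<bar> \<le> 1"
    using Cauchy_Schwarz_ineq2[of p "y - x"] mult_mono[of "norm p" 1 "norm (y - x)" 1] bounds(2) yN(1) r(2) by simp
  \<comment> \<open>The jet of P at y is within the truncation level 5: the value lies between -2 and 4, and the three
    terms of the gradient have norm at most 2, 2 and 1.\<close>
  have value_bound: "\<bar>P y\<bar> \<le> 5"
  proof -
    have "r \<le> N * r" using mult_right_mono[of 1 N r] N r by simp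
    then have "t + r \<le> 2" using tN r(2) by (simp add: algebra_simps)
    then have "q / 2 * (t + r) \<le> 1 * 2" using q t1 by (intro mult_mono) auto
    moreover have "0 \<le> B * (norm (y - x))\<^sup>2" using B by simp
    ultimately have "w y \<le> 4" using lt Asq py bounds(1) by linarith
    moreover have "- 2 \<le> w y" using contact[OF yb] py bounds(1) by linarith
    ultimately show ?thesis unfolding touch(2) by simp
  qed
  have grad: "norm (quadratic_gradient A r B e p x y) \<le> 5"
  proof -
    have 1: "\<bar>2 * A * (t + r)\<bar> \<le> 2"
    proof -
      have "2 * A * (t + r) \<le> 2 * A * ((N + 1) * r)" using A tN by (intro mult_left_mono) auto
      then show ?thesis using A q t1 by (simp add: abs_mult)
    qed
    have 2: "2 * B * norm (y - x) \<le> 2"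
    proof -
      have "N * (2 * B * norm (y - x)) \<le> N * (2 * B * (N * r))"
        using B yN N by (intro mult_left_mono) auto
      also have "\<dots> = 32 * A * r" using B(2) by (simp add: power2_eq_square)
      also have "\<dots> \<le> 8 * A * N * r" using A N r by (simp add: mult_right_mono)
      also have "\<dots> \<le> 4 * (2 * A * ((N + 1) * r))"
      proof -
        have "4 * (2 * A * ((N + 1) * r)) = 8 * A * N * r + 8 * (A * r)" by (simp add: algebra_simps)
        moreover have "0 \<le> A * r" using A(1) r(1) by simp
        ultimately show ?thesis by linarith
      qed
      also have "\<dots> \<le> N * 2" using A(2) q N by simp
      finally show ?thesis using N by simp
    qed
    have "norm (quadratic_gradient A r B e p x y)
        \<le> norm ((2 * A * (t + r)) *\<^sub>R e) + norm ((2 * B) *\<^sub>R (y - x)) + norm p"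
      unfolding quadratic_gradient_def t_def
      by (rule order_trans[OF norm_triangle_ineq add_right_mono[OF norm_triangle_ineq4]])
    also have "\<dots> \<le> 2 + 2 + 1" using 1 2 bounds B by (intro add_mono) (simp_all add: e)
    finally show ?thesis by simp
  qed
  have "truncated_operator a 5 y (P y) (quadratic_gradient A r B e p x y) (quadratic_hessian A B e) \<le> K"
    using visc U touch yb C2_with_derivs_quadratic[of U A r B e p "w x + m" x, folded P_def]
    unfolding viscosity_le_def by blast
  then have "a y \<bullet> quadratic_hessian A B e \<le> K"
    using value_bound grad by (simp add: truncated_operator_def)
  moreover have "A * lam \<le> a y \<bullet> quadratic_hessian A B e"
  proof -
    have "lam * 1 \<le> a y \<bullet> rank_one e" using ell[OF yb, of e] e(1) by simp
    then have "2 * A * lam \<le> 2 * A * (a y \<bullet> rank_one e)" using A by simp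
    moreover have "a y \<bullet> mat 1 \<le> \<kappa> * norm (mat 1 :: real^'n^'n)"
      using norm_cauchy_schwarz[of "a y" "mat 1"] mult_right_mono[OF coeff[OF yb], of "norm (mat 1 :: real^'n^'n)"] by simp
    then have "2 * B * (a y \<bullet> mat 1) \<le> 2 * B * (\<kappa> * norm (mat 1 :: real^'n^'n))" using B by simp
    moreover have "2 * B * (\<kappa> * norm (mat 1 :: real^'n^'n)) \<le> A * lam"
    proof -
      have "N\<^sup>2 * (2 * B * (\<kappa> * norm (mat 1 :: real^'n^'n))) = A * (32 * \<kappa> * norm (mat 1 :: real^'n^'n))"
        using B(2) by (simp add: algebra_simps)
      also have "\<dots> \<le> A * (lam * N\<^sup>2)" using A N(2) by simp
      finally have "N\<^sup>2 * (2 * B * (\<kappa> * norm (mat 1 :: real^'n^'n))) \<le> N\<^sup>2 * (A * lam)" by (simp add: mult_ac)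
      then show ?thesis using N by simp
    qed
    ultimately show ?thesis by (simp add: quadratic_hessian_def inner_diff_right)
  qed
  ultimately have "A * lam \<le> K" by simp
  then have "2 * ((N + 1) * r) * (A * lam) \<le> 2 * ((N + 1) * r) * K" using N r by simp
  moreover have "2 * ((N + 1) * r) * (A * lam) = q * lam"
    unfolding A(2)[symmetric] by (simp only: mult_ac)
  ultimately have "q * lam \<le> 2 * ((N + 1) * r) * K" by linarith
  also have "\<dots> = 2 * (N + 1) * K * r" by (simp only: mult_ac)
  finally have "q * lam \<le> 2 * (N + 1) * K * r" .
  then show ?thesis using lam by (simp add: pos_le_divide_eq flip: q_def)
qed

text \<open>
  The quadratic growth of w forces the contact point of a small slope to be close to z, hence
  interior. If all contact points were in E, the slope would be a locally Lipschitz function on a null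
  set with a ball in its range.
\<close>

lemma contact_slopes_outside_null_set:
  fixes w :: "real^'n \<Rightarrow> real" and a :: "real^'n \<Rightarrow> real^'n^'n"
  assumes lsc: "lower_semicontinuous_on (cball z \<rho>) w" and \<rho>: "\<rho> > 0"
    and visc: "viscosity_le (ball z \<rho>) (truncated_operator a 5) w (\<lambda>_. K) (ball z \<rho>)" and K: "K \<ge> 0"
    and ell: "\<And>y \<xi>. y \<in> ball z \<rho> \<Longrightarrow> lam * (norm \<xi>)\<^sup>2 \<le> a y \<bullet> rank_one \<xi>" and lam: "lam > 0"
    and coeff: "\<And>y. y \<in> ball z \<rho> \<Longrightarrow> norm (a y) \<le> \<kappa>"
    and w: "w z = 0" "\<And>y. y \<in> cball z \<rho> \<Longrightarrow> \<epsilon> * (norm (y - z))\<^sup>2 \<le> w y" and \<epsilon>: "\<epsilon> > 0"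
    and E: "negligible E" and \<eta>: "\<eta> > 0"
  obtains x p where "x \<in> ball z \<rho>" "x \<notin> E" "norm p < \<eta>" "\<epsilon> * norm (x - z) \<le> norm p"
    "\<And>y. y \<in> ball z \<rho> \<Longrightarrow> w x + p \<bullet> (y - x) \<le> w y"
proof (rule ccontr)
  note that_jet = that
  assume no: "\<not> thesis"
  define \<theta> where "\<theta> = min (min \<eta> 1) (min \<epsilon> (\<epsilon> * \<rho> / 2))"
  have \<theta>: "\<theta> > 0" "\<theta> \<le> \<eta>" "\<theta> \<le> 1" "\<theta> \<le> \<epsilon>" "\<theta> \<le> \<epsilon> * \<rho> / 2"
    using \<eta> \<epsilon> \<rho> by (auto simp: \<theta>_def)
  define contact where "contact x p \<longleftrightarrow> x \<in> ball z (\<rho> / 2) \<and> x \<in> E \<and> norm p < \<theta> \<and> \<bar>w x\<bar> \<le> 1 \<and>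
    (\<forall>y\<in>ball z \<rho>. w x + p \<bullet> (y - x) \<le> w y)" for x p
  have ex: "\<exists>x. contact x p" if p: "norm p < \<theta>" for p
  proof -
    have "lower_semicontinuous_on (cball z \<rho>) (\<lambda>y. w y - p \<bullet> (y - z))"
      by (intro lower_semicontinuous_on_diff lsc continuous_intros)
    then obtain x where x: "x \<in> cball z \<rho>" "\<And>y. y \<in> cball z \<rho> \<Longrightarrow> w x - p \<bullet> (x - z) \<le> w y - p \<bullet> (y - z)"
      using lower_semicontinuous_attains_min[OF compact_cball, of z \<rho>] \<rho> by fastforce
    have touch: "w x + p \<bullet> (y - x) \<le> w y" if "y \<in> ball z \<rho>" for y
      using x(2)[of y] that by (simp add: inner_diff_right)
    have le: "w x \<le> norm p * norm (x - z)"
      using x(2)[of z] \<rho> w(1) norm_cauchy_schwarz[of p "x - z"] by simp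
    have near: "\<epsilon> * norm (x - z) \<le> norm p"
    proof (cases "x = z")
      case False
      have "\<epsilon> * norm (x - z) * norm (x - z) \<le> norm p * norm (x - z)"
        using w(2)[OF x(1)] le by (simp add: power2_eq_square)
      then show ?thesis using False by simp
    qed simp
    have "\<epsilon> * norm (x - z) < \<epsilon> * (\<rho> / 2)" using near p \<theta>(5) by linarith
    then have half: "x \<in> ball z (\<rho> / 2)" using \<epsilon> by (simp add: dist_norm norm_minus_commute)
    have "\<epsilon> * norm (x - z) \<le> \<epsilon> * 1" using near p \<theta>(4) by linarith
    then have "norm (x - z) \<le> 1" using \<epsilon> by simp
    then have "norm p * norm (x - z) \<le> 1 * 1" using p \<theta> by (intro mult_mono) auto
    moreover have "0 \<le> w x" using w(2)[OF x(1)] \<epsilon> by (smt (verit) mult_nonneg_nonneg zero_le_power2)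
    ultimately have "\<bar>w x\<bar> \<le> 1" using le by simp
    moreover have "x \<in> ball z \<rho>" using half \<rho> by simp
    moreover have "x \<in> E"
    proof (rule ccontr)
      assume "x \<notin> E"
      have "thesis"
        by (rule that_jet[OF \<open>x \<in> ball z \<rho>\<close> \<open>x \<notin> E\<close> _ near touch]) (use p \<theta>(2) in auto)
      then show False using no by simp
    qed
    ultimately show ?thesis using half touch p by (auto simp: contact_def)
  qed
  define \<nu> where "\<nu> = norm (mat 1 :: real^'n^'n)"
  have "\<kappa> \<ge> 0" using order_trans[OF norm_ge_zero coeff[of z]] \<rho> by simp
  define N where "N = 4 + 32 * \<kappa> * \<nu> / lam"
  have N: "N \<ge> 4" "32 * \<kappa> * \<nu> \<le> lam * N\<^sup>2"
  proof -
    show "N \<ge> 4" using \<open>\<kappa> \<ge> 0\<close> lam by (simp add: N_def \<nu>_def)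
    then have "lam * N * 1 \<le> lam * N * N" using lam by (intro mult_left_mono) auto
    moreover have "32 * \<kappa> * \<nu> \<le> lam * N" using lam by (simp add: N_def distrib_left)
    ultimately show "32 * \<kappa> * \<nu> \<le> lam * N\<^sup>2" by (simp add: power2_eq_square mult.assoc)
  qed
  \<comment> \<open>Below this scale, the barrier ball around a contact point in the half-radius ball stays in the domain.\<close>
  define r0 where "r0 = min 1 (\<rho> / 4) / N"
  have r0: "r0 > 0" "N * r0 \<le> 1" "N * r0 \<le> \<rho> / 4" using N \<rho> by (auto simp: r0_def)
  define L where "L = 2 * (N + 1) * K / lam"
  have L: "L \<ge> 0" using N K lam by (simp add: L_def)
  have close: "norm (p' - p) \<le> L * r"
    if c: "contact x p" "contact x' p'" and r: "0 < r" "r \<le> r0" "norm (x' - x) \<le> r" for x p x' p' r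
  proof -
    have Nr: "N * r \<le> N * r0" using N r by simp
    then have Nr1: "N * r \<le> 1" using r0(2) by linarith
    have "cball x (N * r) \<subseteq> ball z \<rho>"
    proof
      fix y assume "y \<in> cball x (N * r)"
      then have "dist x y \<le> \<rho> / 4" using Nr r0 by simp
      moreover have "dist z x < \<rho> / 2" using c(1) by (simp add: contact_def)
      ultimately show "y \<in> ball z \<rho>" using dist_triangle[of z y x] \<rho> by simp
    qed
    then show ?thesis unfolding L_def
      using c r Nr1 \<theta> N
      by (intro contact_slopes_close[where z = z and \<rho> = \<rho> and w = w and a = a and \<kappa> = \<kappa> and x = x and x' = x']
        lower_semicontinuous_on_subset[OF lsc] visc K ell lam coeff) (auto simp: contact_def \<nu>_def)
  qed
  \<comment> \<open>The Lipschitz bound holds at every scale r up to r0, also for coinciding contact points, so letting r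
    tend to 0 shows that a contact point has only one slope.\<close>
  have unique: "p' = p" if c: "contact x p" "contact x p'" for x p p'
  proof (rule ccontr)
    assume "p' \<noteq> p"
    define r where "r = min r0 (norm (p' - p) / (2 * (L + 1)))"
    have r: "0 < r" "r \<le> r0" using r0 L \<open>p' \<noteq> p\<close> by (auto simp: r_def)
    have "r \<le> norm (p' - p) / (2 * (L + 1))" unfolding r_def by (rule min.cobounded2)
    then have r3: "r * (2 * (L + 1)) \<le> norm (p' - p)" using L by (subst (asm) pos_le_divide_eq) auto
    have "norm (p' - p) \<le> L * r" using close[OF c, of r] r by simp
    moreover have "L * r < r * (2 * (L + 1))"
      using mult_nonneg_nonneg[OF L, of r] r(1) by (simp add: algebra_simps)
    ultimately show False using r3 by linarith
  qed
  define T where "T = {x. \<exists>p. contact x p}"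
  define slope where "slope x = (SOME p. contact x p)" for x
  have slope: "contact x (slope x)" if "x \<in> T" for x
    using that someI_ex[of "contact x"] by (auto simp: T_def slope_def)
  have "negligible T" by (rule negligible_subset[OF E]) (auto simp: T_def contact_def)
  have "negligible (slope ` T)"
  proof (rule negligible_locally_Lipschitz_image[OF _ \<open>negligible T\<close>])
    fix x assume x: "x \<in> T"
    have "norm (slope y - slope x) \<le> L * norm (y - x)" if "y \<in> T \<inter> ball x r0" for y
    proof (cases "y = x")
      case False
      then show ?thesis
        using that close[OF slope[OF x] slope, of y "norm (y - x)"]
        by (simp add: dist_norm norm_minus_commute)
    qed simp
    then show "\<exists>U B. open U \<and> x \<in> U \<and> (\<forall>y\<in>T \<inter> U. norm (slope y - slope x) \<le> B * norm (y - x))"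
      using r0(1) by (intro exI[of _ "ball x r0"] exI[of _ L]) auto
  qed simp
  moreover have "ball 0 \<theta> \<subseteq> slope ` T"
  proof
    fix p :: "real^'n" assume "p \<in> ball 0 \<theta>"
    then obtain x where x: "contact x p" using ex[of p] by auto
    then have "x \<in> T" by (auto simp: T_def)
    then show "p \<in> slope ` T" using unique[OF slope x] by (metis image_eqI)
  qed
  ultimately have "negligible (ball (0 :: real^'n) \<theta>)" by (rule negligible_subset)
  then show False using open_not_negligible[OF open_ball] \<theta>(1) by (metis centre_in_ball empty_iff)
qed


section \<open>Test functions touching outside a null set\<close>

text \<open>
  Here the contact points of w are turned back into test functions for u. The perturbations s and p
  of value and gradient tend to 0 with the slope; the Hessian changes only through the penalty.
\<close>

lemma test_jets_outside_null_set:
  fixes u \<phi> :: "real^'n \<Rightarrow> real" and a :: "real^'n \<Rightarrow> real^'n^'n"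
  assumes \<Omega>: "open \<Omega>" and lsc: "lower_semicontinuous_on \<Omega> u"
    and visc: "viscosity_le \<Omega> (linear_operator a b c) u (\<lambda>_. C) \<Omega>"
    and coeff: "\<And>x. x \<in> \<Omega> \<Longrightarrow> norm (a x) \<le> \<kappa> \<and> norm (b x) \<le> \<kappa> \<and> \<bar>c x\<bar> \<le> \<kappa>"
    and ell: "\<And>x \<xi>. x \<in> \<Omega> \<Longrightarrow> lam * (norm \<xi>)\<^sup>2 \<le> a x \<bullet> rank_one \<xi>" and lam: "lam > 0"
    and E: "negligible E"
    and U: "open U" "z \<in> U" "U \<subseteq> \<Omega>" and C2: "C2_with_derivs U \<phi> g H"
    and touch: "\<And>x. x \<in> U \<Longrightarrow> \<phi> x \<le> u x" "\<phi> z = u z" and pos: "\<epsilon> > 0" "\<delta> > 0"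
  obtains x s p where "x \<in> U" "norm (x - z) \<le> \<delta>" "\<bar>s\<bar> \<le> \<delta>" "norm p \<le> \<delta>"
    "\<And>F f. viscosity_le \<Omega> F u f (\<Omega> - E) \<Longrightarrow>
      F x (\<phi> x + s) (g x + p) (H x - (2 * \<epsilon>) *\<^sub>R mat 1) \<le> f x"
proof -
  obtain \<rho> where \<rho>: "\<rho> > 0" "cball z \<rho> \<subseteq> U" using U(1,2) open_contains_cball by blast
  define \<beta> where "\<beta> = quadratic 0 0 \<epsilon> 0 0 0 z"
  have \<beta>: "\<beta> y = - \<epsilon> * (norm (y - z))\<^sup>2" for y by (simp add: \<beta>_def quadratic_def)
  note C2e = C2_with_derivs_add[OF C2 C2_with_derivs_quadratic[of U 0 0 \<epsilon> 0 0 0 z, folded \<beta>_def]]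
  define w where "w y = u y - (\<phi> y + \<beta> y)" for y
  obtain K where K: "K \<ge> 0" "viscosity_le (ball z \<rho>) (truncated_operator a 5) w (\<lambda>_. K) (ball z \<rho>)"
    using supersolution_minus_C2[OF visc coeff C2e \<rho>(2) U(3)] unfolding w_def by blast
  have in\<Omega>: "y \<in> \<Omega>" if "y \<in> ball z \<rho>" for y
    using that \<rho>(2) U(3) ball_subset_cball by blast
  have lscw: "lower_semicontinuous_on (cball z \<rho>) w"
    unfolding w_def
    by (intro lower_semicontinuous_on_diff lower_semicontinuous_on_subset[OF lsc] subset_trans[OF \<rho>(2) U(3)]
        continuous_on_subset[OF C2_with_derivs_continuous_on(1)[OF C2e] \<rho>(2)])
  have wz: "w z = 0" using touch(2) by (simp add: w_def \<beta>)
  have wge: "\<epsilon> * (norm (y - z))\<^sup>2 \<le> w y" if "y \<in> cball z \<rho>" for y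
    using touch(1)[of y] that \<rho>(2) by (auto simp: w_def \<beta>)
  \<comment> \<open>The contact point has |x - z| \<le> |p| / \<epsilon>: the bound \<epsilon> \<delta> keeps it within \<delta> of z, the bound \<epsilon> within 1,
    and \<delta> / 3 leaves room for the gradient of the penalty, of size at most 2 |p|.\<close>
  define \<eta> where "\<eta> = min (\<delta> / 3) (min \<epsilon> (\<epsilon> * \<delta>))"
  have \<eta>: "\<eta> > 0" "3 * \<eta> \<le> \<delta>" "\<eta> \<le> \<epsilon>" "\<eta> \<le> \<epsilon> * \<delta>" using pos by (auto simp: \<eta>_def)
  obtain x p where x: "x \<in> ball z \<rho>" "x \<notin> E" and p: "norm p < \<eta>" "\<epsilon> * norm (x - z) \<le> norm p"
    and contact: "\<And>y. y \<in> ball z \<rho> \<Longrightarrow> w x + p \<bullet> (y - x) \<le> w y"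
    using contact_slopes_outside_null_set[OF lscw \<rho>(1) K(2,1) ell[OF in\<Omega>] lam _ wz wge pos(1) E \<eta>(1)]
      coeff in\<Omega> by blast
  define s where "s = \<beta> x + w x"
  define k where "k = w x - p \<bullet> (x - z)"
  define q where "q = p - (2 * \<epsilon>) *\<^sub>R (x - z)"
  define P where "P = quadratic 0 0 \<epsilon> 0 p k z"
  have P: "P y = \<beta> y + w x + p \<bullet> (y - x)" for y
    by (simp add: P_def quadratic_def \<beta> k_def inner_diff_right)
  have "F x (\<phi> x + s) (g x + q) (H x - (2 * \<epsilon>) *\<^sub>R mat 1) \<le> f x"
    if "viscosity_le \<Omega> F u f (\<Omega> - E)" for F f
  proof -
    have "C2_with_derivs (ball z \<rho>) (\<lambda>y. \<phi> y + P y) (\<lambda>y. g y + quadratic_gradient 0 0 \<epsilon> 0 p z y)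
        (\<lambda>y. H y + quadratic_hessian 0 \<epsilon> 0)"
      unfolding P_def
      using \<rho>(2) by (intro C2_with_derivs_add C2_with_derivs_quadratic C2_with_derivs_subset[OF C2]) auto
    moreover have "\<forall>y\<in>ball z \<rho>. \<phi> y + P y \<le> u y"
      using contact by (fastforce simp: P w_def)
    moreover have "\<phi> x + P x = u x" by (simp add: P w_def)
    moreover have "x \<in> \<Omega> - E" "ball z \<rho> \<subseteq> \<Omega>" using x in\<Omega> by auto
    ultimately have "F x (\<phi> x + P x) (g x + quadratic_gradient 0 0 \<epsilon> 0 p z x)
        (H x + quadratic_hessian 0 \<epsilon> 0) \<le> f x"
      using that x(1) open_ball unfolding viscosity_le_def by blast
    moreover have "P x = s" "quadratic_gradient 0 0 \<epsilon> 0 p z x = q"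
      "H x + quadratic_hessian 0 \<epsilon> 0 = H x - (2 * \<epsilon>) *\<^sub>R mat 1"
      by (simp_all add: P s_def q_def quadratic_gradient_def quadratic_hessian_def)
    ultimately show ?thesis by simp
  qed
  moreover have "x \<in> U" using x(1) \<rho>(2) ball_subset_cball by blast
  moreover have "norm (x - z) \<le> \<delta>"
  proof -
    have "\<epsilon> * norm (x - z) \<le> \<epsilon> * \<delta>" using p \<eta>(4) by linarith
    then show ?thesis using pos by simp
  qed
  moreover have "\<bar>s\<bar> \<le> \<delta>"
  proof -
    have "\<epsilon> * norm (x - z) \<le> \<epsilon> * 1" using p \<eta>(3) by linarith
    then have n1: "norm (x - z) \<le> 1" using pos by simp
    have "0 \<le> s" using wge[of x] x(1) by (simp add: s_def \<beta>)
    moreover have "w x \<le> norm p * norm (x - z)"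
      using contact[of z] \<rho>(1) wz norm_cauchy_schwarz[of p "x - z"] by (simp add: inner_diff_right)
    moreover have "norm p * norm (x - z) \<le> norm p * 1" using n1 by (intro mult_left_mono) auto
    moreover have "\<beta> x \<le> 0" using pos by (simp add: \<beta>)
    ultimately show ?thesis using p \<eta>(1,2) by (simp add: s_def)
  qed
  moreover have "norm q \<le> \<delta>"
  proof -
    have "norm q \<le> norm p + 2 * (\<epsilon> * norm (x - z))"
      unfolding q_def using norm_triangle_ineq4[of p "(2 * \<epsilon>) *\<^sub>R (x - z)"] pos by simp
    then show ?thesis using p \<eta>(1,2) by linarith
  qed
  ultimately show thesis using that by blast
qed

theorem theorem1p2:
  fixes \<Omega> E :: "(real^'n) set"
    and F :: "real^'n \<Rightarrow> real \<Rightarrow> real^'n \<Rightarrow> real^'n^'n \<Rightarrow> real"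
    and a :: "real^'n \<Rightarrow> real^'n^'n"
    and b :: "real^'n \<Rightarrow> real^'n"
    and c f u :: "real^'n \<Rightarrow> real"
    and lam Lam C :: real
  assumes "bounded \<Omega>" and "connected \<Omega>" and "open \<Omega>"
    and "continuous_on (\<Omega> \<times> UNIV \<times> UNIV \<times> symmetric_matrices) (\<lambda>(x, s, p, M). F x s p M)"
    and "degenerate_elliptic \<Omega> F"
    and "\<And>i j. (\<lambda>x. a x $ i $ j) \<in> borel_measurable (lebesgue_on \<Omega>)"
    and "\<And>i. (\<lambda>x. b x $ i) \<in> borel_measurable (lebesgue_on \<Omega>)"
    and "c \<in> borel_measurable (lebesgue_on \<Omega>)"
    and "lam > 0" and "Lam > 0"
    and "\<And>x i j. x \<in> \<Omega> \<Longrightarrow> \<bar>a x $ i $ j\<bar> + \<bar>b x $ i\<bar> + \<bar>c x\<bar> \<le> Lam"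
    and "\<And>x \<xi>. x \<in> \<Omega> \<Longrightarrow>
           (\<Sum>i\<in>UNIV. \<Sum>j\<in>UNIV. a x $ i $ j * \<xi> $ i * \<xi> $ j) \<ge> lam * (norm \<xi>)\<^sup>2"
    and "upper_semicontinuous_on \<Omega> f"
    and "lower_semicontinuous_on \<Omega> u"
    and "viscosity_le \<Omega> (linear_operator a b c) u (\<lambda>x. C) \<Omega>"
    and "E \<subseteq> \<Omega>" and "E \<in> null_sets lebesgue"
    and "viscosity_le \<Omega> F u f (\<Omega> - E)"
  shows "viscosity_le \<Omega> F u f \<Omega>"
proof -
  note F_cont = assms(4) and bound = assms(11) and f_usc = assms(13)
  define n where "n = real CARD('n)"
  define \<kappa> where "\<kappa> = n * n * Lam + n * Lam + Lam"
  have coeff: "norm (a x) \<le> \<kappa> \<and> norm (b x) \<le> \<kappa> \<and> \<bar>c x\<bar> \<le> \<kappa>" if x: "x \<in> \<Omega>" for x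
  proof -
    have e: "\<bar>a x $ i $ j\<bar> \<le> Lam" "\<bar>b x $ i\<bar> \<le> Lam" "\<bar>c x\<bar> \<le> Lam" for i j
      using bound[OF x, of i j] by linarith+
    have "norm (b x) \<le> n * Lam"
      using norm_le_l1_cart[of "b x"] sum_bounded_above[of UNIV "\<lambda>i. \<bar>b x $ i\<bar>" Lam] e(2)
      unfolding n_def by force
    moreover have "norm (a x) \<le> n * n * Lam" unfolding n_def by (rule norm_matrix_le) (rule e)
    moreover have "0 \<le> n * n * Lam" "0 \<le> n * Lam" using \<open>Lam > 0\<close> by (simp_all add: n_def)
    ultimately show ?thesis using e(3) \<open>Lam > 0\<close> unfolding \<kappa>_def by (intro conjI; linarith)
  qed
  have ell: "lam * (norm \<xi>)\<^sup>2 \<le> a x \<bullet> rank_one \<xi>" if "x \<in> \<Omega>" for x \<xi>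
    using assms(12)[OF that, of \<xi>] by (simp add: inner_vec_def rank_one_def mult.assoc)
  have E: "negligible E" using assms(17) by (simp add: negligible_iff_null_sets)
  have "F z (\<phi> z) (g z) (H z) \<le> f z"
    if z: "z \<in> \<Omega>" and U: "open U" "z \<in> U" "U \<subseteq> \<Omega>" and C2: "C2_with_derivs U \<phi> g H"
      and touch: "\<forall>x\<in>U. \<phi> x \<le> u x" "\<phi> z = u z" for z U \<phi> g H
  proof (rule ccontr)
    assume "\<not> ?thesis"
    then obtain t where t: "f z < t" "t < F z (\<phi> z) (g z) (H z)" using dense by (auto simp: not_le)
    define d where "d k = 1 / real (Suc k)" for k
    have d: "d k > 0" for k by (simp add: d_def)
    have d0: "d \<longlonglongrightarrow> 0" unfolding d_def by (rule LIMSEQ_Suc[OF lim_1_over_n])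
    have "\<exists>x s p. x \<in> U \<and> norm (x - z) \<le> d k \<and> \<bar>s\<bar> \<le> d k \<and> norm p \<le> d k \<and>
        F x (\<phi> x + s) (g x + p) (H x - (2 * d k) *\<^sub>R mat 1) \<le> f x" for k
      using test_jets_outside_null_set[OF assms(3) assms(14) assms(15) coeff ell \<open>lam > 0\<close> E U C2
          bspec[OF touch(1)] touch(2) d d] assms(18) by metis
    then obtain X s p where X: "\<And>k. X k \<in> U" "\<And>k. norm (X k - z) \<le> d k"
      and s: "\<And>k. \<bar>s k\<bar> \<le> d k" and p: "\<And>k. norm (p k) \<le> d k"
      and le: "\<And>k. F (X k) (\<phi> (X k) + s k) (g (X k) + p k) (H (X k) - (2 * d k) *\<^sub>R mat 1) \<le> f (X k)"
      by metis
    have Xz: "X \<longlonglongrightarrow> z"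
      using Lim_null_comparison[OF _ d0, of "\<lambda>k. X k - z"] X(2) by (simp add: LIM_zero_iff)
    have s0: "s \<longlonglongrightarrow> 0" using Lim_null_comparison[OF _ d0, of s] s by simp
    have p0: "p \<longlonglongrightarrow> 0" using Lim_null_comparison[OF _ d0, of p] p by simp
    have lim: "(\<lambda>k. h (X k)) \<longlonglongrightarrow> h z" if "continuous_on U h"
      for h :: "real^'n \<Rightarrow> 'b::topological_space"
      using continuous_on_tendsto_compose[OF that Xz U(2)] X(1) by simp
    note cont = C2_with_derivs_continuous_on[OF C2]
    have "(\<lambda>k. (X k, \<phi> (X k) + s k, g (X k) + p k, H (X k) - (2 * d k) *\<^sub>R mat 1))
        \<longlonglongrightarrow> (z, \<phi> z + 0, g z + 0, H z - (2 * 0) *\<^sub>R mat 1)"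
      by (intro tendsto_intros Xz s0 p0 d0 lim cont)
    moreover have "H (X k) - (2 * d k) *\<^sub>R mat 1 \<in> symmetric_matrices" for k
      using C2_hessian_symmetric[OF C2 U(1) X(1)[of k]]
      by (simp add: symmetric_matrices_def vec_eq_iff transpose_def mat_def)
    moreover have "H z \<in> symmetric_matrices" by (rule C2_hessian_symmetric[OF C2 U(1,2)])
    ultimately have "(\<lambda>k. F (X k) (\<phi> (X k) + s k) (g (X k) + p k) (H (X k) - (2 * d k) *\<^sub>R mat 1))
        \<longlonglongrightarrow> F z (\<phi> z) (g z) (H z)"
      using continuous_on_tendsto_compose[OF F_cont, of
          "\<lambda>k. (X k, \<phi> (X k) + s k, g (X k) + p k, H (X k) - (2 * d k) *\<^sub>R mat 1)"
          "(z, \<phi> z, g z, H z)" sequentially] subsetD[OF U(3) X(1)] z by simp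
    then have "eventually (\<lambda>k. t < f (X k)) sequentially"
      using order_tendstoD(1)[OF _ t(2)] le by (fastforce elim!: eventually_mono intro: less_le_trans)
    moreover have "eventually (\<lambda>k. f (X k) < t) sequentially"
    proof -
      have "eventually (\<lambda>y. f y < t) (at z within \<Omega>)"
        using f_usc z t(1) unfolding upper_semicontinuous_on_def by blast
      then have "eventually (\<lambda>y. y \<in> \<Omega> \<longrightarrow> f y < t) (nhds z)"
        unfolding eventually_at_filter by (rule eventually_mono) (use t(1) in auto)
      then show ?thesis
        using filterlim_iff[THEN iffD1, OF Xz] X(1) U(3) by (fastforce elim!: eventually_mono)
    qed
    ultimately have "eventually (\<lambda>_. False) sequentially" by eventually_elim simp
    then show False by simp
  qed
  then show ?thesis unfolding viscosity_le_def by blast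
qed

end
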